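(* Let $J=\mathbb{Z}^-$, let $X_1,X_2$ be Hilbert spaces, and let $A_{11}(n)\in\mathcal{L}(X_1)$, $A_{12}(n)\in\mathcal{L}(X_2,X_1)$, $A_{22}(n)\in\mathcal{L}(X_2)$ for $n\in\mathbb{Z}^-$, where $A_{ii}(n)$ is invertible for $i=1,2$ and $n\in\mathbb{Z}^-$. Suppose that the block triangular system $$x(n+1)=\begin{pmatrix}A_{11}(n)&A_{12}(n)\\0&A_{22}(n)\end{pmatrix}x(n),\quad n\in\mathbb{Z}^-\setminus\{0\},$$ on $X_1\times X_2$ admits an exponential dichotomy with respect to projections $P(n)$, $n\in\mathbb{Z}^-$, and that $d:=\dim\mathcal{N}P(0)<+\infty$. Then the block diagonal system $$x(n+1)=\begin{pmatrix}A_{11}(n)&0\\0&A_{22}(n)\end{pmatrix}x(n),\quad n\in\mathbb{Z}^-\setminus\{0\},$$ admits an exponential dichotomy.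
   Context: $\mathbb{Z}^-$ is the set of nonpositive integers. $\mathcal{L}(X,Y)$ denotes the bounded linear operators $X\to Y$, and $\mathcal{L}(X)=\mathcal{L}(X,X)$. $X_1\times X_2$ carries the norm $\|(x_1,x_2)\|=\max\{\|x_1\|,\|x_2\|\}$ (equivalent to its Hilbert norm). Exponential dichotomy. Let $X$ be a Banach space and $(A(n))_{n\in\mathbb{Z}^-}\subset\mathcal{L}(X)$. For $n\le m\le 0$ put $\Phi(m,n)=A(m-1)\cdots A(n)$ if $m>n$ and $\Phi(n,n)=\mathrm{Id}$. The system $x(n+1)=A(n)x(n)$, $n\in\mathbb{Z}^-\setminus\{0\}$, admits an exponential dichotomy (with respect to projections $P(n)$) if there exist (bounded) projections $(P(n))_{n\in\mathbb{Z}^-}\subset\mathcal{L}(X)$ and constants $K,\alpha>0$ such that: (i) for every $n\in\mathbb{Z}^-\setminus\{0\}$, $A(n)P(n)=P(n+1)A(n)$ and $A(n)|_{\mathcal{N}P(n)}:\mathcal{N}P(n)\to\mathcal{N}P(n+1)$ is invertible, where $\mathcal{N}P(n)$ is the kernel of $P(n)$; (ii) $\|\Phi(m,n)P(n)\|\le Ke^{-\alpha(m-n)}$ for $n\le m\le0$; (iii) $\|\Phi(m,n)(\mathrm{Id}-P(n))\|\le Ke^{-\alpha(n-m)}$ for $m\le n\le0$, where for $m\le n$, $\Phi(m,n):=(\Phi(n,m)|_{\mathcal{N}P(m)})^{-1}:\mathcal{N}P(n)\to\mathcal{N}P(m)$. *)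

theory Defs
  imports "HOL-Analysis.Analysis"
begin

text \<open>Normed spaces over the scalar field \<open>'k\<close>.  The multiplicative norm of
  \<^class>\<open>real_normed_field\<close> makes \<open>'k\<close> isomorphic to the reals or the complex numbers
  (Gelfand-Mazur), so one statement covers both.  The real structure is the one of the type class;
  \<open>scale\<close> extends it.

  A Hilbert space over \<open>'k\<close> is a type of sort \<^class>\<open>real_inner\<close> and \<^class>\<open>banach\<close> with such a
  \<open>scale\<close>.  In the complex case \<open>x \<bullet> y\<close> is the real part of the complex inner product, which
  is recovered from it as \<open>x \<bullet> y + \<i> (x \<bullet> scale \<i> y)\<close>
  (linear in \<open>x\<close>); homogeneity of the norm makes this sesquilinear.\<close>

locale normed_space_over = vector_space scale
  for scale :: "'k::real_normed_field \<Rightarrow> 'x::real_normed_vector \<Rightarrow> 'x" +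
  assumes scale_of_real: "scale (of_real r) x = r *\<^sub>R x"
    and norm_scale: "norm (scale c x) = norm c * norm x"

lemma normed_space_over_scaleR:
  "normed_space_over (scaleR :: real \<Rightarrow> 'x::real_normed_vector \<Rightarrow> 'x)"
  by unfold_locales (auto simp: algebra_simps)

lemma normed_space_over_complex:
  "normed_space_over ((*) :: complex \<Rightarrow> complex \<Rightarrow> complex)"
  by unfold_locales (auto simp: algebra_simps norm_mult scaleR_conv_of_real)

definition prod_scale ::
  "('k \<Rightarrow> 'x \<Rightarrow> 'x) \<Rightarrow> ('k \<Rightarrow> 'y \<Rightarrow> 'y) \<Rightarrow> 'k \<Rightarrow> 'x \<times> 'y \<Rightarrow> 'x \<times> 'y" where
  "prod_scale s t c = map_prod (s c) (t c)"

lemma normed_space_over_prod: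
  assumes "normed_space_over s" "normed_space_over t"
  shows "normed_space_over (prod_scale s t)"
proof -
  interpret s: normed_space_over s by fact
  interpret t: normed_space_over t by fact
  show ?thesis
  proof unfold_locales
    fix c and x :: "'b \<times> 'c"
    show "norm (prod_scale s t c x) = norm c * norm x"
      by (cases x) (simp add: prod_scale_def norm_Pair s.norm_scale t.norm_scale
          power_mult_distrib real_sqrt_mult flip: distrib_left)
  qed (auto simp: prod_scale_def s.scale_right_distrib t.scale_right_distrib
      s.scale_left_distrib t.scale_left_distrib s.scale_of_real t.scale_of_real)
qed

text \<open>The product type carries the Hilbert norm.  It is equivalent to the maximum norm, so
  boundedness of operators and, the constant \<open>K\<close> being existentially quantified, exponential
  dichotomies are the same for both norms.\<close>

lemma max_norm_equivalent:
  "max (norm x) (norm y) \<le> norm (x, y)"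
  "norm (x, y) \<le> sqrt 2 * max (norm x) (norm y)"
proof -
  show "max (norm x) (norm y) \<le> norm (x, y)"
    by (metis max.bounded_iff norm_fst_le norm_snd_le)
  have "(norm x)\<^sup>2 + (norm y)\<^sup>2 \<le> 2 * (max (norm x) (norm y))\<^sup>2"
    using power_mono[of "norm x" "max (norm x) (norm y)" 2]
      power_mono[of "norm y" "max (norm x) (norm y)" 2] by simp
  then have "norm (x, y) \<le> sqrt (2 * (max (norm x) (norm y))\<^sup>2)"
    by (simp add: norm_Pair)
  also have "\<dots> = sqrt 2 * max (norm x) (norm y)"
    by (simp add: real_sqrt_mult le_max_iff_disj)
  finally show "norm (x, y) \<le> sqrt 2 * max (norm x) (norm y)" .
qed

definition bounded_operators ::
  "('k::field \<Rightarrow> 'x::real_normed_vector \<Rightarrow> 'x) \<Rightarrow> ('k \<Rightarrow> 'y::real_normed_vector \<Rightarrow> 'y)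
    \<Rightarrow> ('x \<Rightarrow>\<^sub>L 'y) set" where
  "bounded_operators s t = {T. Vector_Spaces.linear s t (blinfun_apply T)}"

definition invertible_op :: "('x::real_normed_vector \<Rightarrow>\<^sub>L 'x) \<Rightarrow> bool" where
  "invertible_op T \<longleftrightarrow> (\<exists>S. S o\<^sub>L T = id_blinfun \<and> T o\<^sub>L S = id_blinfun)"

definition ker :: "('x::real_normed_vector \<Rightarrow>\<^sub>L 'y::real_normed_vector) \<Rightarrow> 'x set" where
  "ker T = {x. blinfun_apply T x = 0}"

definition finite_dim :: "('k::field \<Rightarrow> 'x::real_normed_vector \<Rightarrow> 'x) \<Rightarrow> 'x set \<Rightarrow> bool" where
  "finite_dim s V \<longleftrightarrow> (\<exists>B. finite B \<and> module.span s B = V)"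

primrec evolution :: "(int \<Rightarrow> 'x::real_normed_vector \<Rightarrow>\<^sub>L 'x) \<Rightarrow> int \<Rightarrow> nat \<Rightarrow> 'x \<Rightarrow>\<^sub>L 'x" where
  "evolution A n 0 = id_blinfun"
| "evolution A n (Suc k) = A (n + int k) o\<^sub>L evolution A n k"

text \<open>\<open>\<Phi>(m,n) = A(m-1) \<cdots> A(n)\<close>; meaningful only for \<open>n \<le> m\<close>.\<close>

definition transition :: "(int \<Rightarrow> 'x::real_normed_vector \<Rightarrow>\<^sub>L 'x) \<Rightarrow> int \<Rightarrow> int \<Rightarrow> 'x \<Rightarrow>\<^sub>L 'x" where
  "transition A m n = evolution A n (nat (m - n))"

text \<open>For \<open>m \<le> n\<close>, \<open>\<Phi>(m,n)\<close> is the inverse of \<open>\<Phi>(n,m)\<close> restricted to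
  the kernel of \<open>P(m)\<close>; it is applied only to elements of the kernel of \<open>P(n)\<close>.\<close>

definition backward_transition ::
  "(int \<Rightarrow> 'x::real_normed_vector \<Rightarrow>\<^sub>L 'x) \<Rightarrow> (int \<Rightarrow> 'x \<Rightarrow>\<^sub>L 'x) \<Rightarrow> int \<Rightarrow> int \<Rightarrow> 'x \<Rightarrow> 'x" where
  "backward_transition A P m n = inv_into (ker (P m)) (blinfun_apply (transition A n m))"

text \<open>Systems on the nonpositive integers are families indexed by \<^typ>\<open>int\<close>, whose values at
  positive integers are irrelevant.  In the last clause the bound on the operator norm is written
  out pointwise because the backward transition is not an element of the type of bounded
  operators.\<close>

definition exponential_dichotomy_wrt ::
  "('k::field \<Rightarrow> 'x::real_normed_vector \<Rightarrow> 'x) \<Rightarrow> (int \<Rightarrow> 'x \<Rightarrow>\<^sub>L 'x) \<Rightarrow> (int \<Rightarrow> 'x \<Rightarrow>\<^sub>L 'x) \<Rightarrow> bool" where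
  "exponential_dichotomy_wrt s A P \<longleftrightarrow>
     (\<forall>n\<le>0. P n \<in> bounded_operators s s \<and> P n o\<^sub>L P n = P n) \<and>
     (\<forall>n<0. A n o\<^sub>L P n = P (n + 1) o\<^sub>L A n \<and>
            bij_betw (blinfun_apply (A n)) (ker (P n)) (ker (P (n + 1)))) \<and>
     (\<exists>K>0. \<exists>\<alpha>>0.
        (\<forall>m n. n \<le> m \<and> m \<le> 0 \<longrightarrow>
           norm (transition A m n o\<^sub>L P n) \<le> K * exp (- \<alpha> * of_int (m - n))) \<and>
        (\<forall>m n. m \<le> n \<and> n \<le> 0 \<longrightarrow>
           (\<forall>x. norm (backward_transition A P m n (x - blinfun_apply (P n) x))
                  \<le> K * exp (- \<alpha> * of_int (n - m)) * norm x)))"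

definition exponential_dichotomy ::
  "('k::field \<Rightarrow> 'x::real_normed_vector \<Rightarrow> 'x) \<Rightarrow> (int \<Rightarrow> 'x \<Rightarrow>\<^sub>L 'x) \<Rightarrow> bool" where
  "exponential_dichotomy s A \<longleftrightarrow> (\<exists>P. exponential_dichotomy_wrt s A P)"

definition block_triangular ::
  "('x::real_normed_vector \<Rightarrow>\<^sub>L 'x) \<Rightarrow> ('y::real_normed_vector \<Rightarrow>\<^sub>L 'x) \<Rightarrow> ('y \<Rightarrow>\<^sub>L 'y)
    \<Rightarrow> (('x \<times> 'y) \<Rightarrow>\<^sub>L ('x \<times> 'y))" where
  "block_triangular A B D = Blinfun (\<lambda>(x, y).
     (blinfun_apply A x + blinfun_apply B y, blinfun_apply D y))"

lemma block_triangular_apply [simp]: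
  "blinfun_apply (block_triangular A B D) (x, y) =
     (blinfun_apply A x + blinfun_apply B y, blinfun_apply D y)"
proof -
  have "bounded_linear (\<lambda>z. (blinfun_apply A (fst z) + blinfun_apply B (snd z),
      blinfun_apply D (snd z)))"
    by (intro bounded_linear_Pair bounded_linear_add
        blinfun.bounded_linear_right[THEN bounded_linear_compose]
        bounded_linear_fst bounded_linear_snd)
  then have "bounded_linear (\<lambda>(x, y). (blinfun_apply A x + blinfun_apply B y, blinfun_apply D y))"
    by (simp add: case_prod_unfold)
  then show ?thesis
    by (simp add: block_triangular_def bounded_linear_Blinfun_apply)
qed

end

theory Submission
  imports Defs
begin

text \<open>On a half-line ending at 0, the projection of a dichotomy at time 0 may be replaced by any
  bounded projection with the same kernel.  As \<open>V = ker (P 0)\<close> is finite-dimensional, there is a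
  block triangular one: with \<open>Q\<^sub>1\<close>, \<open>Q\<^sub>2\<close> the orthogonal projections onto \<open>{x. (x, 0) \<in> V}\<close> and
  \<open>snd ` V\<close> and \<open>M\<close> such that \<open>Q\<^sub>1 M = 0\<close> and \<open>(M y, Q\<^sub>2 y) \<in> V\<close> for all \<open>y\<close>, take
  \<open>(x, y) \<mapsto> (x - Q\<^sub>1 x - M y, y - Q\<^sub>2 y)\<close>.  All operators in the dichotomy estimates are then block
  triangular, and the diagonal blocks of such an operator are bounded by its norm, so the estimates
  pass to the block diagonal system.\<close>

section \<open>Finite-dimensional subspaces of Hilbert spaces\<close>

text \<open>On a Hilbert space over \<open>'k\<close>, the field \<open>'k\<close> inherits the parallelogram law.  For \<open>c\<close> of norm 1
  orthogonal to 1 it gives \<open>\<bar>c - 1\<bar>\<^sup>2 = \<bar>c + 1\<bar>\<^sup>2 = 2\<close>, hence \<open>\<bar>c\<^sup>2 - 1\<bar> = 2\<close> and \<open>c\<^sup>2 = -1\<close>.\<close>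

lemma real_or_complex_scalars:
  fixes s :: "'k::real_normed_field \<Rightarrow> 'x::real_inner \<Rightarrow> 'x"
  assumes "normed_space_over s" and x: "(x :: 'x) \<noteq> 0"
  obtains i :: 'k where "\<forall>c. \<exists>a b. c = of_real a + of_real b * i"
proof -
  interpret normed_space_over s by fact
  define u where "u = x /\<^sub>R norm x"
  have u: "norm u = 1" using x by (simp add: u_def)
  have norm_s: "norm (s c u) = norm c" for c by (simp add: norm_scale u)
  have s1: "s 1 u = u" by simp
  \<comment> \<open>The map \<open>c \<mapsto> s c u\<close> is a real-linear isometry of
    \<open>'k\<close> into \<open>'x\<close> taking 1 to \<open>u\<close>, so \<open>re\<close> is
    the inner product with 1 that the field inherits from \<open>'x\<close>.\<close>
  define re where "re c = s c u \<bullet> u" for c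
  have re_of_real: "re (of_real r) = r" for r
    using u by (simp add: re_def scale_of_real dot_square_norm)
  have re_diff: "re (c - d) = re c - re d" for c d
    by (simp add: re_def scale_left_diff_distrib inner_diff_left)
  have plus: "(norm (c + 1))\<^sup>2 = (norm c)\<^sup>2 + 1 + 2 * re c" for c
  proof -
    have "(norm (c + 1))\<^sup>2 = (norm (s c u + u))\<^sup>2"
      by (metis norm_s scale_left_distrib s1)
    then show ?thesis
      by (simp add: power2_norm_eq_inner algebra_simps inner_commute re_def flip: norm_s)
        (simp add: dot_square_norm u)
  qed
  have minus: "(norm (c - 1))\<^sup>2 = (norm c)\<^sup>2 + 1 - 2 * re c" for c
  proof -
    have "(norm (c - 1))\<^sup>2 = (norm (s c u - u))\<^sup>2"
      by (metis norm_s scale_left_diff_distrib s1)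
    then show ?thesis
      by (simp add: power2_norm_eq_inner algebra_simps inner_commute re_def flip: norm_s)
        (simp add: dot_square_norm u)
  qed
  have sq: "c * c = - 1" if "re c = 0" "norm c = 1" for c
  proof -
    have "(norm (c * c - 1))\<^sup>2 = (norm (c + 1))\<^sup>2 * (norm (c - 1))\<^sup>2"
      by (simp add: power_mult_distrib [symmetric] norm_mult [symmetric] algebra_simps)
    then have "(norm (c * c - 1))\<^sup>2 = 4" by (simp add: plus minus that)
    then have "re (c * c) = -1" using minus[of "c * c"] by (simp add: norm_mult that)
    then have "(norm (c * c + 1))\<^sup>2 = 0" by (simp add: plus norm_mult that)
    then show ?thesis by (simp add: eq_neg_iff_add_eq_0)
  qed
  define im where "im c = c - of_real (re c)" for c
  \<comment> \<open>\<open>im c\<close> is the part of \<open>c\<close> orthogonal to 1. Normalised,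
    it meets both assumptions of \<open>sq\<close>; the case \<open>im c = 0\<close> is excluded
    below because \<open>unit c\<close> is then 0.\<close>
  define unit where "unit c = im c / of_real (norm (im c))" for c
  have unit: "unit c * unit c = - 1" "c = of_real (re c) + of_real (norm (im c)) * unit c"
    if "im c \<noteq> 0" for c
  proof -
    have "re (im c) = 0" by (simp add: im_def re_diff re_of_real)
    moreover have "re (d / of_real r) = re d / r" for d r
    proof -
      have "d / of_real r = of_real (inverse r) * d"
        by (simp add: field_class.field_divide_inverse mult.commute)
      then have "s (d / of_real r) u = inverse r *\<^sub>R s d u"
        by (simp only: scale_of_real flip: scale_scale)
      then show ?thesis by (simp add: re_def divide_inverse mult.commute)
    qed
    ultimately have "re (unit c) = 0" by (simp add: unit_def)
    moreover have "norm (unit c) = 1" using that by (simp add: unit_def norm_divide)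
    ultimately show "unit c * unit c = - 1" by (rule sq)
    show "c = of_real (re c) + of_real (norm (im c)) * unit c"
      using that by (simp add: unit_def) (simp add: im_def)
  qed
  show ?thesis
  proof (cases "\<exists>c. im c \<noteq> 0")
    case True
    then obtain c where c: "im c \<noteq> 0" by blast
    show ?thesis
    proof (rule that, intro allI)
      fix d
      show "\<exists>a b. d = of_real a + of_real b * unit c"
      proof (cases "im d = 0")
        case True
        then have "d = of_real (re d) + of_real 0 * unit c" by (simp add: im_def)
        then show ?thesis by blast
      next
        case False
        \<comment> \<open>Two square roots of -1 in a field agree up to sign, so the unit of one
          fixed \<open>c\<close> serves for every \<open>d\<close>.\<close>
        have "(unit d - unit c) * (unit d + unit c) = 0"
          using unit(1)[OF c] unit(1)[OF False] by (simp add: algebra_simps)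
        then have "unit d = unit c \<or> unit d = - unit c"
          by (auto simp: eq_neg_iff_add_eq_0)
        then have "d = of_real (re d) + of_real (norm (im d)) * unit c \<or>
            d = of_real (re d) + of_real (- norm (im d)) * unit c"
          using unit(2)[OF False] by (metis mult_minus_left mult_minus_right of_real_minus)
        then show ?thesis by blast
      qed
    qed
  next
    case False
    \<comment> \<open>All scalars are real in this case, and 0 serves as \<open>i\<close>.\<close>
    have "\<forall>c :: 'k. \<exists>a b. c = of_real a + of_real b * 0"
    proof
      fix c :: 'k
      have "c = of_real (re c) + of_real 0 * 0" using False by (simp add: im_def)
      then show "\<exists>a b. c = of_real a + of_real b * 0" by blast
    qed
    then show ?thesis by (rule that)
  qed
qed

text \<open>A maximal independent subset of \<open>V\<close> spans \<open>V\<close>, and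
  independence inside \<open>span B\<close> bounds its size by that of \<open>B\<close>.\<close>

lemma finite_span_subspace:
  fixes V :: "'x::real_vector set"
  assumes "subspace V" "finite B" "V \<subseteq> span B"
  obtains C where "finite C" "span C = V"
proof -
  obtain C where C: "C \<subseteq> V" "independent C" "V \<subseteq> span C"
    using maximal_independent_subset by blast
  have "finite C" using independent_span_bound[OF assms(2) C(2)] C(1) assms(3) by blast
  moreover have "span C = V" using C(1,3) assms(1) by (simp add: span_minimal subset_antisym)
  ultimately show ?thesis by (rule that)
qed

text \<open>For \<open>c = a + b i\<close>, the vector \<open>c v\<close> is a real combination of
  \<open>v\<close> and \<open>i v\<close>. Hence a spanning set over \<open>'k\<close> together with
  its multiples by \<open>i\<close> spans over the reals, where orthogonalisation for the real inner
  product is available.\<close>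

lemma finite_dim_imp_finite_real_span:
  fixes s :: "'k::real_normed_field \<Rightarrow> 'x::real_inner \<Rightarrow> 'x"
  assumes "normed_space_over s" "finite_dim s V"
  obtains C where "finite C" "span C = V"
proof -
  interpret normed_space_over s by fact
  obtain B where B: "finite B" "module.span s B = V"
    using assms(2) by (auto simp: finite_dim_def)
  have scaleR: "r *\<^sub>R v = s (of_real r) v" for r v by (simp add: scale_of_real)
  have sub: "real_vector.subspace V"
    unfolding B(2)[symmetric] real_vector.subspace_def scaleR
    by (auto intro: span_add span_scale span_zero)
  show ?thesis
  proof (cases "\<exists>x :: 'x. x \<noteq> 0")
    \<comment> \<open>The trivial space is treated apart: \<open>real_or_complex_scalars\<close>
      asks for a nonzero vector.\<close>
    case False
    then have "V = {0}" using real_vector.subspace_0[OF sub] by auto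
    then show ?thesis using that[of "{}"] by simp
  next
    case True
    then obtain x :: 'x where "x \<noteq> 0" by blast
    then obtain i :: 'k where i: "\<forall>c. \<exists>a b. c = of_real a + of_real b * i"
      by (rule real_or_complex_scalars[OF assms(1)])
    define D where "D = B \<union> s i ` B"
    have si: "s i v \<in> real_vector.span D" if "v \<in> real_vector.span D" for v
      using that
    proof (induction rule: real_vector.span_induct_alt)
      case base
      then show ?case by (simp add: real_vector.span_zero)
    next
      case (step r v w)
      obtain a b where ab: "i * i = of_real a + of_real b * i" using i by blast
      have "s i v \<in> real_vector.span D"
      proof (cases "v \<in> B")
        case True
        then show ?thesis by (auto simp: D_def intro: real_vector.span_base)
      next
        case False
        then obtain w where w: "w \<in> B" "v = s i w" using step(1) by (auto simp: D_def)
        have "s i v = s (i * i) w" by (simp add: w(2))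
        then have "s i v = a *\<^sub>R w + b *\<^sub>R v"
          by (simp only: w(2) ab scale_left_distrib scale_of_real flip: scale_scale)
        moreover have "w \<in> D" using w by (auto simp: D_def)
        ultimately show ?thesis
          using step(1) by (simp add: real_vector.span_add real_vector.span_scale real_vector.span_base)
      qed
      moreover have "s i (r *\<^sub>R v + w) = r *\<^sub>R s i v + s i w"
        by (simp add: scale_right_distrib scaleR mult.commute)
      ultimately show ?case
        using step by (auto intro!: real_vector.span_add real_vector.span_scale)
    qed
    have "V \<subseteq> real_vector.span D"
    proof
      fix v assume "v \<in> V"
      then have "v \<in> span B" using B by simp
      then show "v \<in> real_vector.span D"
      proof (induction rule: span_induct_alt)
        case base
        then show ?case by (simp add: real_vector.span_zero)
      next
        case (step c v w)
        obtain a b where ab: "c = of_real a + of_real b * i" using i by blast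
        have "s c v = a *\<^sub>R v + b *\<^sub>R s i v"
          by (simp add: ab scale_left_distrib scale_of_real flip: scale_scale)
        moreover have "v \<in> D" "s i v \<in> D" using step(1) by (auto simp: D_def)
        ultimately show ?case
          using step by (simp add: real_vector.span_add real_vector.span_scale real_vector.span_base)
      qed
    qed
    moreover have "finite D" using B(1) by (simp add: D_def)
    ultimately obtain C where "finite C" "real_vector.span C = V"
      using finite_span_subspace[OF sub] by blast
    then show ?thesis by (rule that)
  qed
qed

text \<open>\<open>g\<close> after \<open>L\<close> is the orthogonal projection onto the image of
  \<open>span C\<close> under \<open>g\<close>, while \<open>L\<close> itself chooses preimages in
  \<open>span C\<close> linearly. With \<open>g\<close> the second coordinate, \<open>L\<close>
  yields a projection together with a matching first coordinate.\<close>

lemma orthogonal_projection_lift: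
  fixes g :: "'z::real_normed_vector \<Rightarrow>\<^sub>L 'y::real_inner"
  assumes "finite C"
  obtains L :: "'y \<Rightarrow>\<^sub>L 'z"
  where "\<And>y. L y \<in> span C" "\<And>y v. v \<in> g ` span C \<Longrightarrow> orthogonal (y - g (L y)) v"
proof -
  have lin: "linear (blinfun_apply g)" 
    by (rule bounded_linear.linear[OF blinfun.bounded_linear_right])
  have "finite (g ` C)" using assms by simp
  then obtain E where E: "finite E" "span E = span (g ` C)" "pairwise orthogonal E"
    using basis_orthogonal by blast
  have image: "g ` span C = span E" using linear_span_image[OF lin, of C] E(2) by simp
  have "\<forall>e\<in>E. \<exists>w\<in>span C. g w = e" using image span_base[of _ E] by (metis imageE)
  then obtain h where h: "\<And>e. e \<in> E \<Longrightarrow> h e \<in> span C" "\<And>e. e \<in> E \<Longrightarrow> g (h e) = e" by metis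
  \<comment> \<open>The expansion of \<open>y\<close> in the orthogonal system \<open>E\<close>,
    with each \<open>e\<close> replaced by its preimage \<open>h e\<close>. A zero vector in
    \<open>E\<close> gets coefficient 0, since division by 0 is 0.\<close>
  define f where "f y = (\<Sum>e\<in>E. ((y \<bullet> e) / (e \<bullet> e)) *\<^sub>R h e)" for y
  have "bounded_linear f"
    unfolding f_def divide_inverse
    by (intro bounded_linear_sum bounded_linear_scaleR_const bounded_linear_mult_const
        bounded_linear_inner_left)
  then have f: "blinfun_apply (Blinfun f) = f" by (rule bounded_linear_Blinfun_apply)
  show ?thesis
  proof (rule that[of "Blinfun f"])
    show "Blinfun f y \<in> span C" for y
      unfolding f unfolding f_def by (intro span_sum span_scale h)
    fix y v assume "v \<in> g ` span C"
    then have "v \<in> span E" using image by simp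
    moreover have "orthogonal (y - g (f y)) e" if "e \<in> E" for e
    proof -
      have "g (f y) \<bullet> e = (\<Sum>d\<in>E. ((y \<bullet> d) / (d \<bullet> d)) * (d \<bullet> e))"
        by (simp add: f_def blinfun.sum_right blinfun.scaleR_right inner_sum_left h)
      also have "\<dots> = (\<Sum>d\<in>E. if d = e then y \<bullet> e else 0)"
        using E(3) that by (intro sum.cong) (auto simp: pairwise_def orthogonal_def)
      also have "\<dots> = y \<bullet> e" using that E(1) by simp
      finally show ?thesis by (simp add: orthogonal_def inner_diff_left)
    qed
    ultimately show "orthogonal (y - g (Blinfun f y)) v"
      unfolding f by (rule orthogonal_to_span)
  qed
qed

text \<open>Homogeneity over \<open>'k\<close> comes from the nearest-point property, because the inner product at hand
  is only real bilinear.\<close>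

lemma orthogonal_projection_linear:
  fixes s :: "'k::real_normed_field \<Rightarrow> 'x::real_inner \<Rightarrow> 'x" and Q :: "'x \<Rightarrow>\<^sub>L 'x"
  assumes "normed_space_over s" and V: "subspace V"
    and inv: "\<And>c v. v \<in> V \<Longrightarrow> s c v \<in> V"
    and Q: "\<And>x. Q x \<in> V" "\<And>x v. v \<in> V \<Longrightarrow> orthogonal (x - Q x) v"
  shows "Q \<in> bounded_operators s s"
proof -
  interpret normed_space_over s by fact
  have pyth: "(norm (x - v))\<^sup>2 = (norm (x - Q x))\<^sup>2 + (norm (Q x - v))\<^sup>2" if "v \<in> V" for x v
  proof -
    have "orthogonal (x - Q x) (Q x - v)" using that Q
      by (intro Q(2) real_vector.subspace_diff[OF V])
    from norm_add_Pythagorean[OF this] show ?thesis by simp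
  qed
  have nearest: "norm (x - Q x) \<le> norm (x - v)" if "v \<in> V" for x v
    using pyth[OF that, of x] by (simp add: power2_le_imp_le)
  \<comment> \<open>Scaling by a nonzero \<open>c\<close> multiplies distances by
    \<open>norm c\<close>, so \<open>s c (Q x)\<close> is at least as near to \<open>s c x\<close>
    as \<open>Q (s c x)\<close> is. Pythagoras at \<open>Q (s c x)\<close> then forces the two
    points to coincide.\<close>
  have "Q (s c x) = s c (Q x)" for c x
  proof (cases "c = 0")
    case True
    then show ?thesis by simp
  next
    case False
    have "norm (s c x - s c (Q x)) = norm c * norm (x - Q x)"
      by (simp add: norm_scale flip: scale_right_diff_distrib)
    also have "\<dots> \<le> norm c * norm (x - s (inverse c) (Q (s c x)))"
      by (intro mult_left_mono nearest inv Q) simp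
    also have "\<dots> = norm (s c x - Q (s c x))"
      using False by (simp add: scale_right_diff_distrib flip: norm_scale)
    finally have "(norm (s c x - s c (Q x)))\<^sup>2 \<le> (norm (s c x - Q (s c x)))\<^sup>2"
      by (simp add: power_mono)
    then have "(norm (Q (s c x) - s c (Q x)))\<^sup>2 \<le> 0"
      using pyth[OF inv[OF Q(1)], of "s c x" c x] by linarith
    then show ?thesis by simp
  qed
  then show ?thesis
    by (simp add: bounded_operators_def Vector_Spaces.linear_iff blinfun.add_right vector_space_axioms)
qed

section \<open>Block triangular operators and evolution families\<close>

lemma id_blinfun_compose [simp]: "id_blinfun o\<^sub>L T = T" "T o\<^sub>L id_blinfun = T"
  by (rule blinfun_eqI, simp)+

lemma block_triangular_compose:
  "block_triangular A B D o\<^sub>L block_triangular A' B' D' =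
     block_triangular (A o\<^sub>L A') ((A o\<^sub>L B') + (B o\<^sub>L D')) (D o\<^sub>L D')"
  by (rule blinfun_eqI) (auto simp: blinfun.add_left blinfun.add_right)

lemma block_triangular_id [simp]: "block_triangular id_blinfun 0 id_blinfun = id_blinfun"
  by (rule blinfun_eqI) auto

text \<open>\<open>A\<close> is the restriction to the first factor, where the corner
  \<open>B\<close> does not act; \<open>D\<close> is the second coordinate of the restriction to the
  second factor.\<close>

lemma norm_block_triangular_diagonal:
  fixes A :: "'a::real_normed_vector \<Rightarrow>\<^sub>L 'a" and D :: "'b::real_normed_vector \<Rightarrow>\<^sub>L 'b"
  shows
    "norm A \<le> norm (block_triangular A B D)" "norm D \<le> norm (block_triangular A B D)"
proof -
  show "norm A \<le> norm (block_triangular A B D)"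
  proof (rule norm_blinfun_bound)
    fix x
    have "norm (A x) = norm (block_triangular A B D (x, 0))" by (simp add: norm_Pair)
    also have "\<dots> \<le> norm (block_triangular A B D) * norm (x, 0 :: 'b)" by (rule norm_blinfun)
    finally show "norm (A x) \<le> norm (block_triangular A B D) * norm x" by (simp add: norm_Pair)
  qed simp
  show "norm D \<le> norm (block_triangular A B D)"
  proof (rule norm_blinfun_bound)
    fix y
    have "norm (D y) \<le> norm (block_triangular A B D (0, y))" by (simp add: norm_snd_le)
    also have "\<dots> \<le> norm (block_triangular A B D) * norm (0 :: 'a, y)" by (rule norm_blinfun)
    finally show "norm (D y) \<le> norm (block_triangular A B D) * norm y" by (simp add: norm_Pair)
  qed simp
qed

lemma norm_block_diagonal:
  fixes A :: "'a::real_normed_vector \<Rightarrow>\<^sub>L 'a" and D :: "'b::real_normed_vector \<Rightarrow>\<^sub>L 'b"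
  shows "norm (block_triangular A 0 D) \<le> norm A + norm D"
proof (rule norm_blinfun_bound)
  fix z :: "'a \<times> 'b"
  obtain x y where z: "z = (x, y)" by fastforce
  have "norm (block_triangular A 0 D z) \<le> norm (A x) + norm (D y)"
    by (simp add: z norm_Pair_le)
  also have "\<dots> \<le> norm A * norm z + norm D * norm z"
    by (intro add_mono norm_blinfun[THEN order_trans] mult_left_mono)
      (simp_all add: z norm_fst_le norm_snd_le)
  finally show "norm (block_triangular A 0 D z) \<le> (norm A + norm D) * norm z"
    by (simp add: algebra_simps)
qed simp

text \<open>The corner \<open>C\<close> is left unspecified because only the diagonal blocks survive
  the passage to the block diagonal system.\<close>

lemma evolution_block_triangular:
  obtains C where
    "evolution (\<lambda>n. block_triangular (A n) (B n) (D n)) n k =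
       block_triangular (evolution A n k) C (evolution D n k)"
proof -
  have "\<exists>C. evolution (\<lambda>n. block_triangular (A n) (B n) (D n)) n k =
       block_triangular (evolution A n k) C (evolution D n k)"
    by (induction k) (auto simp: block_triangular_compose intro: block_triangular_id[symmetric])
  then show ?thesis using that by blast
qed

lemma evolution_block_diagonal:
  "evolution (\<lambda>n. block_triangular (A n) 0 (D n)) n k =
     block_triangular (evolution A n k) 0 (evolution D n k)"
  by (induction k) (simp_all add: block_triangular_compose)

section \<open>Closure properties of scalar-linear bounded operators\<close>

lemma bounded_operators_compose:
  assumes "S \<in> bounded_operators s t" "T \<in> bounded_operators r s"
  shows "S o\<^sub>L T \<in> bounded_operators r t"
  using assms by (simp add: bounded_operators_def Vector_Spaces.linear_iff)

lemma bounded_operators_id: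
  assumes "normed_space_over s"
  shows "id_blinfun \<in> bounded_operators s s"
  using assms by (simp add: bounded_operators_def Vector_Spaces.linear_iff normed_space_over_def)

lemma bounded_operators_inverse:
  assumes "T \<in> bounded_operators s t" "S o\<^sub>L T = id_blinfun" "T o\<^sub>L S = id_blinfun"
  shows "S \<in> bounded_operators t s"
proof -
  have ST: "S (T x) = x" and TS: "T (S y) = y" for x y
    using assms(2,3) by (metis blinfun_apply_blinfun_compose id_blinfun.rep_eq)+
  have "S (t c y) = s c (S y)" for c y
    using assms(1) by (metis (lifting) ST TS bounded_operators_def mem_Collect_eq Vector_Spaces.linear_iff)
  then show ?thesis
    using assms(1) by (simp add: bounded_operators_def Vector_Spaces.linear_iff blinfun.add_right)
qed

lemma bounded_operators_diff:
  assumes "S \<in> bounded_operators s t" "T \<in> bounded_operators s t"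
  shows "S - T \<in> bounded_operators s t"
  using assms
  by (simp add: bounded_operators_def Vector_Spaces.linear_iff blinfun.diff_left
      module.scale_right_diff_distrib module_iff_vector_space)

lemma bounded_operators_block_diagonal:
  assumes "normed_space_over s" "normed_space_over t"
    "A \<in> bounded_operators s s" "D \<in> bounded_operators t t"
  shows "block_triangular A 0 D \<in> bounded_operators (prod_scale s t) (prod_scale s t)"
  using assms normed_space_over_prod[OF assms(1,2)]
  by (auto simp: bounded_operators_def Vector_Spaces.linear_iff prod_scale_def normed_space_over_def
      blinfun.add_right)

lemma bounded_operators_evolution:
  assumes "normed_space_over s" "\<And>m. n \<le> m \<Longrightarrow> m < n + int k \<Longrightarrow> A m \<in> bounded_operators s s"
  shows "evolution A n k \<in> bounded_operators s s"
  using assms(2) by (induction k) (auto intro!: bounded_operators_compose bounded_operators_id assms(1))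

section \<open>Composition and invertibility of transition operators\<close>

lemma evolution_add: "evolution A n (j + k) = evolution A (n + int j) k o\<^sub>L evolution A n j"
  by (induction k) (auto intro!: blinfun_eqI simp: add.assoc)

lemma transition_self [simp]: "transition A n n = id_blinfun"
  by (simp add: transition_def)

lemma transition_trans:
  assumes "n \<le> m" "m \<le> l"
  shows "transition A l n = transition A l m o\<^sub>L transition A m n"
proof -
  have "nat (l - n) = nat (m - n) + nat (l - m)" using assms by simp
  then show ?thesis using assms by (simp add: transition_def evolution_add)
qed

lemma transition_step: "transition A (n + 1) n = A n"
  by (auto intro!: blinfun_eqI simp: transition_def)

lemma invertible_op_compose:
  assumes "invertible_op S" "invertible_op T"
  shows "invertible_op (S o\<^sub>L T)"
proof -
  obtain S' T' where "S' o\<^sub>L S = id_blinfun" "S o\<^sub>L S' = id_blinfun"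
    "T' o\<^sub>L T = id_blinfun" "T o\<^sub>L T' = id_blinfun"
    using assms by (auto simp: invertible_op_def)
  then have "S' (S x) = x" "S (S' x) = x" "T' (T x) = x" "T (T' x) = x" for x
    by (metis blinfun_apply_blinfun_compose id_blinfun.rep_eq)+
  then have "(T' o\<^sub>L S') o\<^sub>L (S o\<^sub>L T) = id_blinfun" "(S o\<^sub>L T) o\<^sub>L (T' o\<^sub>L S') = id_blinfun"
    by (auto intro!: blinfun_eqI)
  then show ?thesis unfolding invertible_op_def by blast
qed

lemma invertible_op_evolution:
  assumes "\<And>m. n \<le> m \<Longrightarrow> m < n + int k \<Longrightarrow> invertible_op (A m)"
  shows "invertible_op (evolution A n k)"
  using assms
proof (induction k)
  case 0
  show ?case unfolding invertible_op_def by (intro exI[of _ id_blinfun]) (auto intro: blinfun_eqI)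
qed (auto intro!: invertible_op_compose)

section \<open>Dichotomies of invertible systems\<close>

definition inverse_transitions ::
  "(int \<Rightarrow> 'x::real_normed_vector \<Rightarrow>\<^sub>L 'x) \<Rightarrow> (int \<Rightarrow> 'x \<Rightarrow>\<^sub>L 'x) \<Rightarrow> bool" where
  "inverse_transitions A F \<longleftrightarrow>
     (\<forall>n\<le>0. F n o\<^sub>L transition A 0 n = id_blinfun \<and> transition A 0 n o\<^sub>L F n = id_blinfun)"

lemma inverse_transitions_exist:
  assumes "\<And>n. n < 0 \<Longrightarrow> invertible_op (A n)"
  obtains F where "inverse_transitions A F"
proof -
  have "\<exists>G. G o\<^sub>L transition A 0 n = id_blinfun \<and> transition A 0 n o\<^sub>L G = id_blinfun" if "n \<le> 0" for n
    using invertible_op_evolution[of n "nat (0 - n)" A] assms that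
    by (simp add: invertible_op_def transition_def)
  then have "\<exists>F. inverse_transitions A F" unfolding inverse_transitions_def by metis
  then show ?thesis using that by blast
qed

lemma inverse_transitions_apply:
  assumes "inverse_transitions A F" "n \<le> 0"
  shows "F n (transition A 0 n x) = x" "transition A 0 n (F n x) = x"
  using assms unfolding inverse_transitions_def
  by (metis blinfun_apply_blinfun_compose id_blinfun.rep_eq)+

text \<open>Cancel \<open>\<Phi>(0,m)\<close> on the left of
  \<open>\<Phi>(0,n) = \<Phi>(0,m) \<Phi>(m,n)\<close>.\<close>

lemma transition_via_zero:
  assumes "inverse_transitions A F" "n \<le> m" "m \<le> 0"
  shows "transition A m n x = F m (transition A 0 n x)"
  using transition_trans[OF assms(2,3), of A] inverse_transitions_apply(1)[OF assms(1,3)] by simp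

text \<open>One-step invariance, iterated up to time 0. Once \<open>\<Phi>(0,n)\<close> is inverted,
  this exhibits every \<open>P n\<close> as a conjugate of \<open>P 0\<close>.\<close>

lemma dichotomy_projection_commutes:
  assumes "exponential_dichotomy_wrt s A P" "n \<le> 0"
  shows "transition A 0 n (P n x) = P 0 (transition A 0 n x)"
proof -
  have step: "A m (P m x) = P (m + 1) (A m x)" if "m < 0" for m x
    using assms(1) that unfolding exponential_dichotomy_wrt_def
    by (metis blinfun_apply_blinfun_compose)
  have "transition A 0 (- int k) (P (- int k) x) = P 0 (transition A 0 (- int k) x)" for k
  proof (induction k arbitrary: x)
    case (Suc k)
    \<comment> \<open>The earliest factor, which acts first, is split off, so that the induction
      hypothesis applies to the image of \<open>x\<close> under it.\<close>
    have "transition A 0 (- int (Suc k)) = transition A 0 (- int k) o\<^sub>L A (- int (Suc k))"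
      using transition_trans[of "- int (Suc k)" "- int k" 0 A]
        transition_step[of A "- int (Suc k)"] by simp
    then show ?case using Suc step[of "- int (Suc k)" x] by simp
  qed simp
  from this[of "nat (- n)"] assms(2) show ?thesis by simp
qed

lemma norm_blinfun_le_iff:
  assumes "0 \<le> c"
  shows "norm T \<le> c \<longleftrightarrow> (\<forall>x. norm (blinfun_apply T x) \<le> c * norm x)"
  using norm_blinfun_bound[OF assms] norm_blinfun[of T]
  by (meson mult_right_mono norm_ge_zero order_trans)

text \<open>\<open>F n\<close> stands for the inverse of \<open>E n = \<Phi>(0,n)\<close>.  For invertible systems
  \<open>\<Phi>(m,n) = F m \<circ> E n\<close> for all \<open>m\<close>, \<open>n\<close>, and a dichotomy is determined by \<open>R = P 0\<close>.\<close>

definition dichotomy_estimates ::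
  "(int \<Rightarrow> 'x::real_normed_vector \<Rightarrow>\<^sub>L 'x) \<Rightarrow> (int \<Rightarrow> 'x \<Rightarrow>\<^sub>L 'x) \<Rightarrow> ('x \<Rightarrow>\<^sub>L 'x) \<Rightarrow> real \<Rightarrow> real \<Rightarrow> bool" where
  "dichotomy_estimates E F R K \<alpha> \<longleftrightarrow>
     (\<forall>m n. n \<le> m \<and> m \<le> 0 \<longrightarrow> norm (F m o\<^sub>L (R o\<^sub>L E n)) \<le> K * exp (- \<alpha> * of_int (m - n))) \<and>
     (\<forall>m n. m \<le> n \<and> n \<le> 0 \<longrightarrow>
        norm (F m o\<^sub>L ((id_blinfun - R) o\<^sub>L E n)) \<le> K * exp (- \<alpha> * of_int (n - m)))"

text \<open>For conjugates of a single projection the invariance and bijectivity clauses hold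
  automatically, since \<open>A n = F (n + 1) \<circ> E n\<close>; only the norm bounds remain. One
  direction extracts the bounds from the triangular system, the other rebuilds a dichotomy of the
  diagonal one.\<close>

lemma exponential_dichotomy_wrt_iff_estimates:
  fixes R :: "'x::real_normed_vector \<Rightarrow>\<^sub>L 'x"
  assumes F: "inverse_transitions A F"
    and P: "\<And>n. n \<le> 0 \<Longrightarrow> P n \<in> bounded_operators s s"
    and R: "\<And>x. R (R x) = R x"
    and conj: "\<And>n x. n \<le> 0 \<Longrightarrow> P n x = F n (R (transition A 0 n x))"
  shows "exponential_dichotomy_wrt s A P \<longleftrightarrow>
    (\<exists>K>0. \<exists>\<alpha>>0. dichotomy_estimates (transition A 0) F R K \<alpha>)"
proof -
  define E where "E = transition A 0"
  have FE: "F n (E n x) = x" and EF: "E n (F n x) = x" if "n \<le> 0" for n x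
    using inverse_transitions_apply[OF F that] by (simp_all add: E_def)
  have trans: "transition A m n x = F m (E n x)" if "n \<le> m" "m \<le> 0" for m n x
    using transition_via_zero[OF F that] by (simp add: E_def)
  have A: "A n x = F (n + 1) (E n x)" if "n < 0" for n x
    using trans[of n "n + 1" x] that by (simp add: transition_step)
  have P_eq: "P n x = F n (R (E n x))" if "n \<le> 0" for n x
    using conj[OF that] by (simp add: E_def)
  have ker: "x \<in> ker (P n) \<longleftrightarrow> R (E n x) = 0" if "n \<le> 0" for n x
    using EF[OF that] that by (auto simp: ker_def P_eq) (metis blinfun.zero_right)
  have "\<forall>n\<le>0. P n \<in> bounded_operators s s \<and> P n o\<^sub>L P n = P n"
    using P by (auto intro!: blinfun_eqI simp: P_eq EF R)
  moreover have "\<forall>n<0. A n o\<^sub>L P n = P (n + 1) o\<^sub>L A n \<and>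
      bij_betw (blinfun_apply (A n)) (ker (P n)) (ker (P (n + 1)))"
  proof (intro allI impI conjI)
    fix n :: int assume n: "n < 0"
    show "A n o\<^sub>L P n = P (n + 1) o\<^sub>L A n"
      using n by (intro blinfun_eqI) (simp add: A P_eq EF)
    show "bij_betw (blinfun_apply (A n)) (ker (P n)) (ker (P (n + 1)))"
      by (rule bij_betw_byWitness[where f' = "\<lambda>x. F n (E (n + 1) x)"])
        (use n in \<open>auto simp: A ker EF FE\<close>)
  qed
  moreover have "norm (transition A m n o\<^sub>L P n) = norm (F m o\<^sub>L (R o\<^sub>L E n))" if "n \<le> m" "m \<le> 0" for m n
    using that by (intro arg_cong[where f = norm] blinfun_eqI) (simp add: trans P_eq EF)
  moreover have "backward_transition A P m n (x - P n x) = (F m o\<^sub>L ((id_blinfun - R) o\<^sub>L E n)) x"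
    if "m \<le> n" "n \<le> 0" for m n x
    \<comment> \<open>The forward transition from \<open>m\<close> to \<open>n\<close> is injective
      with inverse \<open>F m \<circ> E n\<close>, so it suffices to check that the claimed value
      lies in \<open>ker (P m)\<close> and is mapped to \<open>x - P n x\<close>.\<close>
    unfolding backward_transition_def
  proof (rule inv_into_f_eq)
    show "inj_on (blinfun_apply (transition A n m)) (ker (P m))"
      by (rule inj_on_inverseI[where g = "\<lambda>x. F m (E n x)"]) (use that in \<open>simp add: trans EF FE\<close>)
    show "(F m o\<^sub>L ((id_blinfun - R) o\<^sub>L E n)) x \<in> ker (P m)"
      using that by (simp add: ker EF blinfun.diff_left blinfun.diff_right R)
    show "transition A n m ((F m o\<^sub>L ((id_blinfun - R) o\<^sub>L E n)) x) = x - P n x"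
      using that by (simp add: trans EF FE blinfun.diff_left blinfun.diff_right P_eq)
  qed
  ultimately show ?thesis
    unfolding exponential_dichotomy_wrt_def dichotomy_estimates_def E_def[symmetric]
    by (simp add: norm_blinfun_le_iff cong: imp_cong conj_cong)
qed

text \<open>On a half-line only the kernel of the projection matters: for two projections with the same
  kernel, \<open>R' - R = (1 - R)(R' - R)R\<close>, so the additional term decays in both directions.\<close>

lemma dichotomy_estimates_same_kernel:
  fixes R R' :: "'x::real_normed_vector \<Rightarrow>\<^sub>L 'x"
  assumes est: "dichotomy_estimates E F R K \<alpha>" and "K > 0" "\<alpha> > 0"
    and zero: "\<And>x. E 0 x = x" "\<And>x. F 0 x = x"
    and R: "\<And>x. R (R x) = R x" "\<And>x. R' (R x) = R' x" "\<And>x. R (R' x) = R x"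
  shows "dichotomy_estimates E F R' (K + K * norm (R' - R) * K) \<alpha>"
proof -
  \<comment> \<open>This is \<open>F m \<circ> (R' - R) \<circ> E n\<close> split at time 0: a
    forward factor from \<open>n\<close> to 0 on the right, a backward factor from 0 to
    \<open>m\<close> on the left. The identities \<open>E 0\<close> and \<open>F 0\<close> are
    inserted to match the form of the estimates.\<close>
  define D where "D m n = (F m o\<^sub>L ((id_blinfun - R) o\<^sub>L E 0)) o\<^sub>L ((R' - R) o\<^sub>L (F 0 o\<^sub>L (R o\<^sub>L E n)))"
    for m n
  have D: "D m n x = F m (R' (E n x)) - F m (R (E n x))" for m n x
    by (simp add: D_def zero blinfun.diff_left blinfun.diff_right R)
  have norm_D: "norm (D m n) \<le> K * norm (R' - R) * K * exp (\<alpha> * of_int (m + n))"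
    if "m \<le> 0" "n \<le> 0" for m n
  proof -
    have "norm (F m o\<^sub>L ((id_blinfun - R) o\<^sub>L E 0)) \<le> K * exp (- \<alpha> * of_int (0 - m))"
      "norm (F 0 o\<^sub>L (R o\<^sub>L E n)) \<le> K * exp (- \<alpha> * of_int (0 - n))"
      using est that order_refl[of "0 :: int"] unfolding dichotomy_estimates_def by blast+
    then have "norm (D m n) \<le>
        (K * exp (- \<alpha> * of_int (0 - m))) * (norm (R' - R) * (K * exp (- \<alpha> * of_int (0 - n))))"
      unfolding D_def using \<open>K > 0\<close>
      by (intro order_trans[OF norm_blinfun_compose mult_mono[OF _ order_trans[OF norm_blinfun_compose mult_left_mono]]])
        simp_all
    also have "\<dots> = K * norm (R' - R) * K * exp (\<alpha> * of_int (m + n))"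
      by (simp add: exp_add distrib_left)
    finally show ?thesis .
  qed
  \<comment> \<open>For nonpositive \<open>m\<close> and \<open>n\<close>, both \<open>m - n\<close>
    and \<open>n - m\<close> are at most \<open>-(m + n)\<close>, so the decay of
    \<open>D m n\<close> serves either estimate, with \<open>l\<close> the elapsed time.\<close>
  have combine: "norm T \<le> (K + K * norm (R' - R) * K) * exp (- \<alpha> * of_int l)"
    if "norm S \<le> K * exp (- \<alpha> * of_int l)" "norm T \<le> norm S + norm (D m n)"
      "m \<le> 0" "n \<le> 0" "l \<le> - (m + n)" for S T :: "'x \<Rightarrow>\<^sub>L 'x" and l m n
  proof -
    have "\<alpha> * of_int (m + n) \<le> \<alpha> * - of_int l"
      using that(5) \<open>\<alpha> > 0\<close> by (intro mult_left_mono) linarith+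
    then have "exp (\<alpha> * of_int (m + n)) \<le> exp (- \<alpha> * of_int l)" by simp
    then have "norm (D m n) \<le> K * norm (R' - R) * K * exp (- \<alpha> * of_int l)"
      using \<open>K > 0\<close> by (intro norm_D[OF that(3,4), THEN order_trans] mult_left_mono) simp_all
    then show ?thesis using that(1,2) by (simp add: distrib_right)
  qed
  show ?thesis
    unfolding dichotomy_estimates_def
  proof (intro conjI allI impI)
    fix m n :: int assume mn: "n \<le> m \<and> m \<le> 0"
    have "F m o\<^sub>L (R' o\<^sub>L E n) = (F m o\<^sub>L (R o\<^sub>L E n)) + D m n"
      by (rule blinfun_eqI) (simp add: blinfun.add_left D)
    then show "norm (F m o\<^sub>L (R' o\<^sub>L E n)) \<le> (K + K * norm (R' - R) * K) * exp (- \<alpha> * of_int (m - n))"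
      using est mn unfolding dichotomy_estimates_def
      by (intro combine[of "F m o\<^sub>L (R o\<^sub>L E n)" _ _ m n]) (auto intro: norm_triangle_ineq)
  next
    fix m n :: int assume mn: "m \<le> n \<and> n \<le> 0"
    have "F m o\<^sub>L ((id_blinfun - R') o\<^sub>L E n) = (F m o\<^sub>L ((id_blinfun - R) o\<^sub>L E n)) - D m n"
      by (rule blinfun_eqI) (simp add: blinfun.diff_left blinfun.diff_right D)
    then show "norm (F m o\<^sub>L ((id_blinfun - R') o\<^sub>L E n)) \<le> (K + K * norm (R' - R) * K) * exp (- \<alpha> * of_int (n - m))"
      using est mn unfolding dichotomy_estimates_def
      by (intro combine[of "F m o\<^sub>L ((id_blinfun - R) o\<^sub>L E n)" _ _ m n]) (auto intro: norm_triangle_ineq4)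
  qed
qed

lemma id_blinfun_diff_block_triangular:
  "id_blinfun - block_triangular A B D = block_triangular (id_blinfun - A) (- B) (id_blinfun - D)"
  by (rule blinfun_eqI) (auto simp: blinfun.diff_left blinfun.minus_left)

text \<open>Diagonal blocks of products and differences involve diagonal blocks only, so erasing the
  corners keeps the diagonal blocks of each estimated operator. The factor 2 comes from adding the
  bounds for the two blocks.\<close>

lemma dichotomy_estimates_diagonal:
  fixes E\<^sub>1 :: "int \<Rightarrow> 'a::real_normed_vector \<Rightarrow>\<^sub>L 'a" and E\<^sub>2 :: "int \<Rightarrow> 'b::real_normed_vector \<Rightarrow>\<^sub>L 'b"
  assumes est: "dichotomy_estimates (\<lambda>n. block_triangular (E\<^sub>1 n) (C n) (E\<^sub>2 n))
      (\<lambda>n. block_triangular (F\<^sub>1 n) (D n) (F\<^sub>2 n)) (block_triangular R\<^sub>1 M R\<^sub>2) K \<alpha>"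
  shows "dichotomy_estimates (\<lambda>n. block_triangular (E\<^sub>1 n) 0 (E\<^sub>2 n))
      (\<lambda>n. block_triangular (F\<^sub>1 n) 0 (F\<^sub>2 n)) (block_triangular R\<^sub>1 0 R\<^sub>2) (2 * K) \<alpha>"
proof -
  have double: "norm (block_triangular T 0 S) \<le> 2 * K * e" if "norm (block_triangular T G S) \<le> K * e"
    for T :: "'a \<Rightarrow>\<^sub>L 'a" and S :: "'b \<Rightarrow>\<^sub>L 'b" and G e
    using norm_block_diagonal[of T S] norm_block_triangular_diagonal(1)[of T G S]
      norm_block_triangular_diagonal(2)[of S T G] that by linarith
  show ?thesis
    using est unfolding dichotomy_estimates_def
    by (simp add: block_triangular_compose id_blinfun_diff_block_triangular) (blast intro: double)
qed

section \<open>Triangular projections\<close>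

text \<open>\<open>x - Q x\<close> lies in \<open>V\<close> and is therefore orthogonal to
  itself.\<close>

lemma orthogonal_projection_fixes:
  fixes Q :: "'x::real_inner \<Rightarrow>\<^sub>L 'x"
  assumes "subspace V" "x \<in> V" "\<And>x. Q x \<in> V" "\<And>x v. v \<in> V \<Longrightarrow> orthogonal (x - Q x) v"
  shows "Q x = x"
proof -
  have "orthogonal (x - Q x) (x - Q x)" using assms by (intro assms(4) subspace_diff)
  then show ?thesis by (simp add: orthogonal_self)
qed

text \<open>The last two identities say that the projections have the same kernel, in the form that
  \<open>dichotomy_estimates_same_kernel\<close> takes. Scalar-linearity is recorded for the two
  blocks that reappear in the diagonal projection.\<close>

lemma triangular_projection_same_kernel:
  fixes R :: "('a::real_inner \<times> 'b::real_inner) \<Rightarrow>\<^sub>L ('a \<times> 'b)"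
    and s :: "'k::real_normed_field \<Rightarrow> 'a \<Rightarrow> 'a" and t :: "'k \<Rightarrow> 'b \<Rightarrow> 'b"
  assumes st: "normed_space_over s" "normed_space_over t"
    and R_lin: "R \<in> bounded_operators (prod_scale s t) (prod_scale s t)"
    and R_idem: "\<And>z. R (R z) = R z"
    and fin: "finite_dim (prod_scale s t) (ker R)"
  obtains R\<^sub>1 M R\<^sub>2 where "R\<^sub>1 \<in> bounded_operators s s" "R\<^sub>2 \<in> bounded_operators t t"
    "\<And>x. R\<^sub>1 (R\<^sub>1 x) = R\<^sub>1 x" "\<And>y. R\<^sub>2 (R\<^sub>2 y) = R\<^sub>2 y"
    "\<And>z. block_triangular R\<^sub>1 M R\<^sub>2 (R z) = block_triangular R\<^sub>1 M R\<^sub>2 z"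
    "\<And>z. R (block_triangular R\<^sub>1 M R\<^sub>2 z) = R z"
proof -
  define V where "V = ker R"
  obtain C where C: "finite C" "span C = V"
    using finite_dim_imp_finite_real_span[OF normed_space_over_prod[OF st] fin] by (auto simp: V_def)
  have V: "subspace V" using subspace_span[of C] C by simp
  have scale_V: "(s c x, t c y) \<in> V" if "(x, y) \<in> V" for c x y
  proof -
    have R_scale: "R (prod_scale s t c z) = prod_scale s t c (R z)" for z
      using R_lin unfolding bounded_operators_def Vector_Spaces.linear_iff by blast
    have "prod_scale s t c 0 = 0"
      using normed_space_over_prod[OF st]
      by (simp add: normed_space_over_def module.scale_zero_right module_iff_vector_space)
    then show ?thesis using that R_scale[of "(x, y)"] by (simp add: V_def ker_def prod_scale_def)
  qed
  define U\<^sub>1 where "U\<^sub>1 = {x. (x, 0) \<in> V}"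
  define U\<^sub>2 where "U\<^sub>2 = snd ` V"
  have U\<^sub>1: "subspace U\<^sub>1"
    unfolding U\<^sub>1_def subspace_def
    using subspace_0[OF V] subspace_add[OF V, of "(_, 0)" "(_, 0)"] subspace_scale[OF V, of "(_, 0)"]
    by (auto simp: zero_prod_def)
  have U\<^sub>2: "subspace U\<^sub>2"
    unfolding U\<^sub>2_def by (rule linear_subspace_image[OF linear_snd V])
  have "U\<^sub>1 \<subseteq> fst ` V" by (force simp: U\<^sub>1_def)
  also have "fst ` V = span (fst ` C)" using linear_span_image[OF linear_fst, of C] C by simp
  finally obtain C\<^sub>1 where C\<^sub>1: "finite C\<^sub>1" "span C\<^sub>1 = U\<^sub>1"
    using finite_span_subspace[OF U\<^sub>1] C(1) by blast
  obtain Q\<^sub>1 :: "'a \<Rightarrow>\<^sub>L 'a" where Q\<^sub>1: "\<And>x. Q\<^sub>1 x \<in> U\<^sub>1"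
    "\<And>x v. v \<in> U\<^sub>1 \<Longrightarrow> orthogonal (x - Q\<^sub>1 x) v"
    using orthogonal_projection_lift[OF C\<^sub>1(1), of id_blinfun] C\<^sub>1(2) by auto
  \<comment> \<open>\<open>L y\<close> is a vector of \<open>V\<close> lying above the orthogonal
    projection of \<open>y\<close> onto \<open>U\<^sub>2\<close>.\<close>
  obtain L :: "'b \<Rightarrow>\<^sub>L ('a \<times> 'b)" where L: "\<And>y. L y \<in> V"
    "\<And>y v. v \<in> U\<^sub>2 \<Longrightarrow> orthogonal (y - snd (L y)) v"
    using orthogonal_projection_lift[OF C(1), of snd_blinfun] C(2) by (auto simp: U\<^sub>2_def)
  define Q\<^sub>2 where "Q\<^sub>2 = snd_blinfun o\<^sub>L L"
  \<comment> \<open>Removing the \<open>Q\<^sub>1\<close> component from the first coordinate of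
    \<open>L y\<close> gives \<open>Q\<^sub>1 M = 0\<close>; the pair stays in \<open>V\<close>
    because the removed vector, paired with 0, lies in \<open>V\<close>.\<close>
  define M where "M = (id_blinfun - Q\<^sub>1) o\<^sub>L (fst_blinfun o\<^sub>L L)"
  have Q\<^sub>2: "Q\<^sub>2 y \<in> U\<^sub>2" "\<And>v. v \<in> U\<^sub>2 \<Longrightarrow> orthogonal (y - Q\<^sub>2 y) v" for y
    using L by (auto simp: Q\<^sub>2_def U\<^sub>2_def)
  have fix\<^sub>1: "Q\<^sub>1 x = x" if "x \<in> U\<^sub>1" for x
    by (rule orthogonal_projection_fixes[OF U\<^sub>1 that Q\<^sub>1])
  have fix\<^sub>2: "Q\<^sub>2 y = y" if "y \<in> U\<^sub>2" for y
    by (rule orthogonal_projection_fixes[OF U\<^sub>2 that Q\<^sub>2])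
  have Q\<^sub>1_M: "Q\<^sub>1 (M y) = 0" for y
    by (simp add: M_def blinfun.diff_left blinfun.diff_right fix\<^sub>1[OF Q\<^sub>1(1)])
  have M_V: "(M y, Q\<^sub>2 y) \<in> V" for y
  proof -
    have "(Q\<^sub>1 (fst (L y)), 0) \<in> V" using Q\<^sub>1(1) by (simp add: U\<^sub>1_def)
    from subspace_diff[OF V L(1) this, of y] show ?thesis
      by (simp add: M_def Q\<^sub>2_def blinfun.diff_left minus_prod_def)
  qed
  define R' where "R' = block_triangular (id_blinfun - Q\<^sub>1) (- M) (id_blinfun - Q\<^sub>2)"
  have R': "R' (x, y) = (x - Q\<^sub>1 x - M y, y - Q\<^sub>2 y)" for x y
    by (simp add: R'_def blinfun.diff_left blinfun.minus_left)
  have R'_V: "R' z = 0" if "z \<in> V" for z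
  proof -
    obtain x y where z: "z = (x, y)" by fastforce
    have y: "Q\<^sub>2 y = y" using that by (intro fix\<^sub>2) (force simp: U\<^sub>2_def z)
    \<comment> \<open>\<open>(x, y)\<close> and \<open>(M y, y)\<close> both lie in
      \<open>V\<close>, and their difference has second coordinate 0.\<close>
    have "x - M y \<in> U\<^sub>1"
      using subspace_diff[OF V that M_V[of y]] by (simp add: U\<^sub>1_def z y)
    then have "Q\<^sub>1 x = x - M y" using fix\<^sub>1[of "x - M y"] by (simp add: blinfun.diff_right Q\<^sub>1_M)
    then show ?thesis by (simp add: z R' y zero_prod_def)
  qed
  have V_R': "z - R' z \<in> V" for z
  proof -
    obtain x y where z: "z = (x, y)" by fastforce
    have "(Q\<^sub>1 x, 0) \<in> V" using Q\<^sub>1(1) by (simp add: U\<^sub>1_def)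
    from subspace_add[OF V this M_V[of y]] show ?thesis by (simp add: z R' add.commute)
  qed
  show ?thesis
  proof (rule that)
    have "Q\<^sub>1 \<in> bounded_operators s s"
    proof (rule orthogonal_projection_linear[OF st(1) U\<^sub>1 _ Q\<^sub>1])
      fix c x assume "x \<in> U\<^sub>1"
      moreover have "t c 0 = 0"
        using st(2) by (simp add: normed_space_over_def module.scale_zero_right module_iff_vector_space)
      ultimately show "s c x \<in> U\<^sub>1" using scale_V[of x 0 c] by (simp add: U\<^sub>1_def)
    qed
    then show "id_blinfun - Q\<^sub>1 \<in> bounded_operators s s"
      by (intro bounded_operators_diff bounded_operators_id st)
    have "Q\<^sub>2 \<in> bounded_operators t t"
    proof (rule orthogonal_projection_linear[OF st(2) U\<^sub>2 _ Q\<^sub>2])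
      fix c y assume "y \<in> U\<^sub>2"
      then obtain x where "(x, y) \<in> V" by (auto simp: U\<^sub>2_def)
      from imageI[OF scale_V[OF this], of snd] show "t c y \<in> U\<^sub>2" by (simp add: U\<^sub>2_def)
    qed
    then show "id_blinfun - Q\<^sub>2 \<in> bounded_operators t t"
      by (intro bounded_operators_diff bounded_operators_id st)
    show "(id_blinfun - Q\<^sub>1) ((id_blinfun - Q\<^sub>1) x) = (id_blinfun - Q\<^sub>1) x" for x
      by (simp add: blinfun.diff_left blinfun.diff_right fix\<^sub>1[OF Q\<^sub>1(1)])
    show "(id_blinfun - Q\<^sub>2) ((id_blinfun - Q\<^sub>2) y) = (id_blinfun - Q\<^sub>2) y" for y
      by (simp add: blinfun.diff_left blinfun.diff_right fix\<^sub>2[OF Q\<^sub>2(1)])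
    fix z
    have "z - R z \<in> V" by (simp add: V_def ker_def blinfun.diff_right R_idem)
    from R'_V[OF this]
    show "block_triangular (id_blinfun - Q\<^sub>1) (- M) (id_blinfun - Q\<^sub>2) (R z) =
        block_triangular (id_blinfun - Q\<^sub>1) (- M) (id_blinfun - Q\<^sub>2) z"
      by (simp add: blinfun.diff_right flip: R'_def)
    show "R (block_triangular (id_blinfun - Q\<^sub>1) (- M) (id_blinfun - Q\<^sub>2) z) = R z"
      using V_R'[of z] by (simp add: V_def ker_def blinfun.diff_right flip: R'_def)
  qed
qed

section \<open>Transfer of the dichotomy from the triangular to the diagonal system\<close>

theorem theorem12:
  fixes scale1 :: "'k::real_normed_field \<Rightarrow> 'a::{real_inner, banach} \<Rightarrow> 'a"
    and scale2 :: "'k \<Rightarrow> 'b::{real_inner, banach} \<Rightarrow> 'b"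
    and A11 :: "int \<Rightarrow> 'a \<Rightarrow>\<^sub>L 'a"
    and A12 :: "int \<Rightarrow> 'b \<Rightarrow>\<^sub>L 'a"
    and A22 :: "int \<Rightarrow> 'b \<Rightarrow>\<^sub>L 'b"
    and P :: "int \<Rightarrow> ('a \<times> 'b) \<Rightarrow>\<^sub>L ('a \<times> 'b)"
  assumes "normed_space_over scale1" and "normed_space_over scale2"
    and "\<And>n. n \<le> 0 \<Longrightarrow> A11 n \<in> bounded_operators scale1 scale1"
    and "\<And>n. n \<le> 0 \<Longrightarrow> A12 n \<in> bounded_operators scale2 scale1"
    and "\<And>n. n \<le> 0 \<Longrightarrow> A22 n \<in> bounded_operators scale2 scale2"
    and "\<And>n. n \<le> 0 \<Longrightarrow> invertible_op (A11 n)"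
    and "\<And>n. n \<le> 0 \<Longrightarrow> invertible_op (A22 n)"
    and "exponential_dichotomy_wrt (prod_scale scale1 scale2)
           (\<lambda>n. block_triangular (A11 n) (A12 n) (A22 n)) P"
    and "finite_dim (prod_scale scale1 scale2) (ker (P 0))"
  shows "exponential_dichotomy (prod_scale scale1 scale2)
           (\<lambda>n. block_triangular (A11 n) 0 (A22 n))"
proof -
  let ?s = "prod_scale scale1 scale2"
  define T where "T n = block_triangular (A11 n) (A12 n) (A22 n)" for n
  define D where "D n = block_triangular (A11 n) 0 (A22 n)" for n
  define E\<^sub>1 where "E\<^sub>1 = transition A11 0"
  define E\<^sub>2 where "E\<^sub>2 = transition A22 0"
  have P: "exponential_dichotomy_wrt ?s T P" using assms(8) by (simp add: T_def[abs_def])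
  obtain F\<^sub>1 where F\<^sub>1: "inverse_transitions A11 F\<^sub>1"
    using inverse_transitions_exist assms(6) by (metis less_imp_le)
  obtain F\<^sub>2 where F\<^sub>2: "inverse_transitions A22 F\<^sub>2"
    using inverse_transitions_exist assms(7) by (metis less_imp_le)
  have inv: "F\<^sub>1 n (E\<^sub>1 n x) = x" "E\<^sub>1 n (F\<^sub>1 n x) = x" "F\<^sub>2 n (E\<^sub>2 n y) = y" "E\<^sub>2 n (F\<^sub>2 n y) = y"
    if "n \<le> 0" for n x y
    using inverse_transitions_apply[OF F\<^sub>1 that] inverse_transitions_apply[OF F\<^sub>2 that]
    by (simp_all add: E\<^sub>1_def E\<^sub>2_def)
  have "\<exists>G. transition T 0 n = block_triangular (E\<^sub>1 n) G (E\<^sub>2 n)" for n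
    using evolution_block_triangular[of A11 A12 A22 n "nat (0 - n)"]
    unfolding transition_def T_def[abs_def] E\<^sub>1_def E\<^sub>2_def by metis
  then obtain G where G: "transition T 0 = (\<lambda>n. block_triangular (E\<^sub>1 n) (G n) (E\<^sub>2 n))" by metis
  \<comment> \<open>The corner of the inverse of an upper triangular block matrix with corner
    \<open>G n\<close>.\<close>
  define H where "H n = - (F\<^sub>1 n o\<^sub>L (G n o\<^sub>L F\<^sub>2 n))" for n
  define F where "F n = block_triangular (F\<^sub>1 n) (H n) (F\<^sub>2 n)" for n
  have F: "inverse_transitions T F"
    unfolding inverse_transitions_def G F_def H_def
    by (auto intro!: blinfun_eqI simp: inv blinfun.minus_left blinfun.add_right blinfun.diff_right)
  have trans_D: "transition D 0 = (\<lambda>n. block_triangular (E\<^sub>1 n) 0 (E\<^sub>2 n))"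
    by (rule ext)
      (simp add: D_def[abs_def] E\<^sub>1_def E\<^sub>2_def transition_def evolution_block_diagonal)
  define F\<^sub>D where "F\<^sub>D n = block_triangular (F\<^sub>1 n) 0 (F\<^sub>2 n)" for n
  have F\<^sub>D: "inverse_transitions D F\<^sub>D"
    unfolding inverse_transitions_def trans_D F\<^sub>D_def by (auto intro!: blinfun_eqI simp: inv)

  have P_lin: "P n \<in> bounded_operators ?s ?s" and P_idem: "P n (P n z) = P n z" if "n \<le> 0" for n z
    using P that unfolding exponential_dichotomy_wrt_def by (metis blinfun_apply_blinfun_compose)+
  have conj: "P n z = F n (P 0 (transition T 0 n z))" if "n \<le> 0" for n z
    by (metis dichotomy_projection_commutes[OF P that] inverse_transitions_apply(1)[OF F that])
  obtain K \<alpha> where K: "K > 0" "\<alpha> > 0" "dichotomy_estimates (transition T 0) F (P 0) K \<alpha>"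
    using iffD1[OF exponential_dichotomy_wrt_iff_estimates[OF F P_lin P_idem[OF order_refl] conj] P]
    by blast
  obtain R\<^sub>1 M R\<^sub>2 where R: "R\<^sub>1 \<in> bounded_operators scale1 scale1" "R\<^sub>2 \<in> bounded_operators scale2 scale2"
    "\<And>x. R\<^sub>1 (R\<^sub>1 x) = R\<^sub>1 x" "\<And>y. R\<^sub>2 (R\<^sub>2 y) = R\<^sub>2 y"
    "\<And>z. block_triangular R\<^sub>1 M R\<^sub>2 (P 0 z) = block_triangular R\<^sub>1 M R\<^sub>2 z"
    "\<And>z. P 0 (block_triangular R\<^sub>1 M R\<^sub>2 z) = P 0 z"
    by (rule triangular_projection_same_kernel
        [OF assms(1,2) P_lin[OF order_refl] P_idem[OF order_refl] assms(9)])
      (rule that)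
  define K' where "K' = K + K * norm (block_triangular R\<^sub>1 M R\<^sub>2 - P 0) * K"
  have F0: "F 0 x = x" for x using inverse_transitions_apply(1)[OF F, of 0 x] by simp
  have "dichotomy_estimates (transition T 0) F (block_triangular R\<^sub>1 M R\<^sub>2) K' \<alpha>"
    unfolding K'_def
    by (rule dichotomy_estimates_same_kernel[OF K(3,1,2)]) (simp_all add: F0 P_idem R)
  then have est: "dichotomy_estimates (transition D 0) F\<^sub>D (block_triangular R\<^sub>1 0 R\<^sub>2) (2 * K') \<alpha>"
    unfolding G F_def[abs_def] trans_D F\<^sub>D_def[abs_def] by (rule dichotomy_estimates_diagonal)

  \<comment> \<open>The diagonal projection chosen at time 0, carried back to time \<open>n\<close>
    by the diagonal system.\<close>
  define P\<^sub>D where "P\<^sub>D n = F\<^sub>D n o\<^sub>L (block_triangular R\<^sub>1 0 R\<^sub>2 o\<^sub>L transition D 0 n)" for n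
  have P\<^sub>D_lin: "P\<^sub>D n \<in> bounded_operators ?s ?s" if n: "n \<le> 0" for n
  proof -
    have D_lin: "D m \<in> bounded_operators ?s ?s" if "m \<le> 0" for m
      unfolding D_def by (intro bounded_operators_block_diagonal assms(1,2) assms(3,5)[OF that])
    have E: "transition D 0 n \<in> bounded_operators ?s ?s"
      unfolding transition_def
      by (rule bounded_operators_evolution[OF normed_space_over_prod[OF assms(1,2)]])
        (use n in \<open>auto intro: D_lin\<close>)
    have "F\<^sub>D n \<in> bounded_operators ?s ?s"
      by (rule bounded_operators_inverse[OF E])
        (use F\<^sub>D n in \<open>auto simp: inverse_transitions_def\<close>)
    then show ?thesis
      unfolding P\<^sub>D_def
      by (rule bounded_operators_compose[OF _ bounded_operators_compose
            [OF bounded_operators_block_diagonal[OF assms(1,2) R(1,2)] E]])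
  qed
  have idem: "block_triangular R\<^sub>1 0 R\<^sub>2 (block_triangular R\<^sub>1 0 R\<^sub>2 z) = block_triangular R\<^sub>1 0 R\<^sub>2 z" for z
    by (cases z) (simp add: R(3,4))
  have P\<^sub>D_apply: "P\<^sub>D n z = F\<^sub>D n (block_triangular R\<^sub>1 0 R\<^sub>2 (transition D 0 n z))" for n z
    by (simp add: P\<^sub>D_def)
  have "2 * K' > 0"
    unfolding K'_def using K(1) by (intro mult_pos_pos add_pos_nonneg mult_nonneg_nonneg) auto
  then have "exponential_dichotomy_wrt ?s D P\<^sub>D"
    using exponential_dichotomy_wrt_iff_estimates[OF F\<^sub>D P\<^sub>D_lin idem P\<^sub>D_apply] est K(2)
    by blast
  then show ?thesis unfolding exponential_dichotomy_def D_def[abs_def] by blast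
qed

end
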